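(* Let $\phi$ be a Schwartz function on $\mathbb{R}$ with $\operatorname{supp}\widehat\phi\subset(-\delta,\delta)$. Let $E=\{(y_k,\eta_k,t_k)\}\subset X=\mathbb{R}\times\mathbb{R}\times(0,\infty)$ be a countable collection of points that is well-separated with separation constants $\alpha>0$ and $\beta\ge4\delta$, i.e. for any two distinct points $(y,\eta,t),(y',\eta',t')\in E$, $$|y-y'|>\alpha\max(t,t')\quad\text{or}\quad|\eta-\eta'|>\beta\max\big(t^{-1},(t')^{-1}\big).$$ Let $s\in(0,1)$. Then for every $f\in L^2(\mathbb{R})$, $$\Big(\sum_k t_k|\langle f,\phi_{y_k,\eta_k,t_k}\rangle|^2\Big)^{1/2}\le C\left(\|f\|_2+\Big[\sup_k|\langle f,\phi_{y_k,\eta_k,t_k}\rangle|\Big(\sum_k t_k\Big)^{1/2}\Big]^{s}\|f\|_2^{1-s}\right),$$ where $C$ depends only on $\phi$, $\alpha$ and $s$.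
   Context: Fourier transform: $\widehat f(\xi)=\int_{\mathbb{R}}e^{-i\xi x}f(x)\,dx$. $\langle f,g\rangle=\int_{\mathbb{R}} f\overline g$, and $\|\cdot\|_2$ is the $L^2(\mathbb{R})$ norm. For $(y,\eta,t)\in X$ the ($L^1$-normalized) wave packet is $$\phi_{y,\eta,t}(x)=e^{-i\eta(y-x)}\,\frac1t\,\overline{\phi\Big(\frac{y-x}{t}\Big)}.$$ *)

theory Defs
  imports "HOL-Analysis.Analysis"
begin

definition nth_deriv :: "nat \<Rightarrow> (real \<Rightarrow> complex) \<Rightarrow> real \<Rightarrow> complex" where
  "nth_deriv n f = ((\<lambda>g x. vector_derivative g (at x)) ^^ n) f"

definition schwartz :: "(real \<Rightarrow> complex) \<Rightarrow> bool" where
  "schwartz f \<longleftrightarrow>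
     (\<forall>n x. nth_deriv n f differentiable (at x)) \<and>
     (\<forall>m n. bounded (range (\<lambda>x. x ^ m *\<^sub>R nth_deriv n f x)))"

definition fourier :: "(real \<Rightarrow> complex) \<Rightarrow> real \<Rightarrow> complex" where
  "fourier f \<xi> = (LINT x|lebesgue. exp (- \<i> * of_real (\<xi> * x)) * f x)"

definition supp :: "(real \<Rightarrow> complex) \<Rightarrow> real set" where
  "supp f = closure {x. f x \<noteq> 0}"

definition in_L2 :: "(real \<Rightarrow> complex) \<Rightarrow> bool" where
  "in_L2 f \<longleftrightarrow> f \<in> borel_measurable lebesgue \<and> integrable lebesgue (\<lambda>x. (cmod (f x))\<^sup>2)"

definition L2_inner :: "(real \<Rightarrow> complex) \<Rightarrow> (real \<Rightarrow> complex) \<Rightarrow> complex" where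
  "L2_inner f g = (LINT x|lebesgue. f x * cnj (g x))"

definition L2_norm :: "(real \<Rightarrow> complex) \<Rightarrow> real" where
  "L2_norm f = sqrt (LINT x|lebesgue. (cmod (f x))\<^sup>2)"

definition X :: "(real \<times> real \<times> real) set" where
  "X = UNIV \<times> UNIV \<times> {0<..}"

fun wave_packet :: "(real \<Rightarrow> complex) \<Rightarrow> real \<times> real \<times> real \<Rightarrow> real \<Rightarrow> complex" where
  "wave_packet \<phi> (y, \<eta>, t) x =
     exp (- \<i> * of_real (\<eta> * (y - x))) * of_real (1 / t) * cnj (\<phi> ((y - x) / t))"

definition well_separated :: "real \<Rightarrow> real \<Rightarrow> (real \<times> real \<times> real) set \<Rightarrow> bool" where
  "well_separated \<alpha> \<beta> E \<longleftrightarrow>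
     (\<forall>(y, \<eta>, t) \<in> E. \<forall>(y', \<eta>', t') \<in> E. (y, \<eta>, t) \<noteq> (y', \<eta>', t') \<longrightarrow>
        \<bar>y - y'\<bar> > \<alpha> * max t t' \<or> \<bar>\<eta> - \<eta>'\<bar> > \<beta> * max (1 / t) (1 / t'))"

text \<open>
  Real powers of extended nonnegative reals. Only exponents \<open>a > 0\<close> are intended,
  for which \<open>\<infinity>\<close> raised to \<open>a\<close> is \<open>\<infinity>\<close>.
\<close>

definition ennreal_pow :: "ennreal \<Rightarrow> real \<Rightarrow> ennreal" where
  "ennreal_pow x a = (if x = \<infinity> then \<infinity> else ennreal (enn2real x powr a))"

end

theory Submission
  imports Defs "HOL-Probability.Characteristic_Functions" "HOL-Probability.Sinc_Integral"
begin

text \<open>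
  If two packets interact, their frequencies are closer than \<open>\<delta> / t + \<delta> / t'\<close>. Fix a packet \<open>p\<close> of
  scale \<open>t\<close>: any two packets of smaller scale interacting with \<open>p\<close> are close in frequency because
  \<open>\<beta> \<ge> 4 * \<delta>\<close>, hence separated in position, and spatial decay makes the one-sided row sum
  \<open>\<Sum> t\<^sub>q \<bar>\<langle>p, q\<rangle>\<bar>\<close> over such \<open>q\<close> bounded. Such row sums give a Bessel inequality
  \<open>\<Sum> t\<^sub>k \<bar>a\<^sub>k\<bar>\<^sup>2 \<le> K \<parallel>f\<parallel>\<^sup>2\<close> for every subfamily on which the coefficients
  \<open>a\<^sub>k = \<langle>f, \<phi>\<^sub>k\<rangle>\<close> are comparable. Splitting into \<open>J\<close> dyadic levels below \<open>sup \<bar>a\<^sub>k\<bar>\<close> and estimating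
  the remaining small coefficients trivially gives
  \<open>\<Sum> t\<^sub>k \<bar>a\<^sub>k\<bar>\<^sup>2 \<le> J K \<parallel>f\<parallel>\<^sup>2 + 4\<^bsup>-J\<^esup> B\<^sup>2\<close> with \<open>B = sup \<bar>a\<^sub>k\<bar> (\<Sum> t\<^sub>k)\<^bsup>1/2\<^esup>\<close>. For
  \<open>J \<approx> log\<^sub>2 (B / \<parallel>f\<parallel>)\<close> only a logarithm of \<open>B / \<parallel>f\<parallel>\<close> is lost, which any power absorbs.
\<close>

subsection \<open>Orthogonality of functions with disjoint Fourier supports\<close>

lemma borel_measurable_cnj [measurable (raw)]:
  assumes "f \<in> borel_measurable M" shows "(\<lambda>x. cnj (f x)) \<in> borel_measurable M"
  using measurable_compose[OF assms, of cnj borel]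
  by (simp add: borel_measurable_continuous_onI continuous_on_cnj)

text \<open>Fubini and affine substitutions are carried out over \<open>lborel\<close>, whereas the
  definition integrates over its completion.\<close>

lemma fourier_eq_lborel:
  assumes "f \<in> borel_measurable borel"
  shows "fourier f \<xi> = (LINT x|lborel. exp (- \<i> * of_real (\<xi> * x)) * f x)"
  unfolding fourier_def using assms by (subst integral_completion) auto

text \<open>By Fubini, a Gaussian average of \<open>h\<close> around 0 is an average of values of
  its Fourier transform, hence vanishes. As the width tends to 0 these averages converge to
  \<open>h 0\<close>.\<close>

lemma fourier_zero_imp_zero:
  fixes h :: "real \<Rightarrow> complex"
  assumes h: "integrable lborel h" and bd: "\<And>x. cmod (h x) \<le> H" and cont: "isCont h 0"
    and F: "\<And>\<xi>. fourier h \<xi> = 0"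
  shows "h 0 = 0"
proof -
  have hm [measurable]: "h \<in> borel_measurable borel" using h by auto
  interpret N: real_distribution std_normal_distribution by (rule real_dist_normal_dist)
  interpret P: pair_sigma_finite lborel std_normal_distribution ..
  have gauss: "(LINT u|lborel. h (e * u) * of_real (std_normal_density u)) = 0" if e: "e > 0" for e
  proof -
    have int: "integrable (lborel \<Otimes>\<^sub>M std_normal_distribution) (\<lambda>(x,z). h x * iexp (x / e * z))"
      by (rule P.Fubini_integrable) (use h in \<open>auto simp: norm_mult intro!: N.integrable_const_bound[of _ "cmod (h _)"]\<close>)
    \<comment> \<open>The characteristic function of the normal law is again a Gaussian. Written as
      an integral it brings in the Fourier transform of \<open>h\<close>; after the substitution
      \<open>x = e * u\<close> it is a multiple of the density.\<close>
    have "(LINT x|lborel. h x * char std_normal_distribution (x / e))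
       = (LINT x|lborel. LINT z|std_normal_distribution. h x * iexp (x / e * z))"
      by (simp add: char_def)
    also have "\<dots> = (LINT z|std_normal_distribution. LINT x|lborel. h x * iexp (x / e * z))"
      using P.Fubini_integral[OF int] by simp
    also have "\<dots> = (LINT z|std_normal_distribution. fourier h (- z / e))"
      by (intro Bochner_Integration.integral_cong refl)
         (simp add: fourier_eq_lborel mult.commute mult.left_commute)
    also have "\<dots> = 0" by (simp add: F)
    finally have "0 = (LINT x|lborel. h x * char std_normal_distribution (x / e))" ..
    also have "\<dots> = e *\<^sub>R (LINT u|lborel. h (e * u) * char std_normal_distribution u)"
      using e by (subst lborel_integral_real_affine[where c=e and t=0]) auto
    also have "\<dots> = e *\<^sub>R (LINT u|lborel. of_real (sqrt (2*pi)) * (h (e * u) * of_real (std_normal_density u)))"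
      unfolding char_std_normal_distribution by (simp add: std_normal_density_def mult.left_commute)
    finally show ?thesis using e by simp
  qed
  have "(\<lambda>n. LINT u|lborel. h (inverse (Suc n) * u) * of_real (std_normal_density u))
     \<longlonglongrightarrow> (LINT u|lborel. h 0 * of_real (std_normal_density u))"
  proof (rule integral_dominated_convergence[where w="\<lambda>u. H * std_normal_density u"])
    show "AE u in lborel. (\<lambda>n. h (inverse (Suc n) * u) * of_real (std_normal_density u))
       \<longlonglongrightarrow> h 0 * of_real (std_normal_density u)"
    proof (rule AE_I2)
      fix u :: real
      have "(\<lambda>n. inverse (real (Suc n)) * u) \<longlonglongrightarrow> 0 * u"
        by (intro tendsto_intros LIMSEQ_inverse_real_of_nat)
      then show "(\<lambda>n. h (inverse (Suc n) * u) * of_real (std_normal_density u))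
          \<longlonglongrightarrow> h 0 * of_real (std_normal_density u)"
        by (intro tendsto_intros isCont_tendsto_compose[OF cont]) simp
    qed
  qed (auto simp: norm_mult bd normal_density_nonneg intro!: mult_right_mono)
  moreover have "(LINT u|lborel. h (inverse (Suc n) * u) * of_real (std_normal_density u)) = 0" for n
    by (rule gauss) simp
  ultimately have "0 = (LINT u|lborel. h 0 * of_real (std_normal_density u))"
    by (simp add: LIMSEQ_const_iff)
  also have "\<dots> = h 0"
    by simp
  finally show ?thesis by simp
qed

lemma L2_inner_eq_lborel:
  assumes "f \<in> borel_measurable borel" "g \<in> borel_measurable borel"
  shows "L2_inner f g = (LINT x|lborel. f x * cnj (g x))"
  unfolding L2_inner_def using assms by (subst integral_completion) auto

text \<open>The correlation \<open>h z = \<integral> f(x) cnj(g(x - z)) dx\<close> has Fourier transform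
  \<open>fourier f \<cdot> cnj (fourier g)\<close> and \<open>h 0 = \<langle>f, g\<rangle>\<close>; this replaces Parseval's identity.\<close>

lemma L2_inner_eq_0_if_fourier_disjoint:
  fixes f g :: "real \<Rightarrow> complex"
  assumes f: "integrable lborel f" and g: "integrable lborel g"
    and contg: "continuous_on UNIV g" and bd: "\<And>x. cmod (g x) \<le> G"
    and F: "\<And>\<xi>. fourier f \<xi> = 0 \<or> fourier g \<xi> = 0"
  shows "L2_inner f g = 0"
proof -
  have [measurable]: "f \<in> borel_measurable borel" "g \<in> borel_measurable borel" using f g by auto
  define h where "h z = (LINT x|lborel. f x * cnj (g (x - z)))" for z
  have shift: "(LINT z|lborel. u (x - z)) = (LINT z|lborel. u z)" for u :: "real \<Rightarrow> complex" and x
    using lborel_integral_real_affine[of "-1" u x] by simp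
  have shift': "(LINT z|lborel. u (x - z)) = (LINT z|lborel. u z)" for u :: "real \<Rightarrow> real" and x
    using lborel_integral_real_affine[of "-1" u x] by simp
  have shifti: "integrable lborel (\<lambda>z. g (x - z))" for x
    using lborel_integrable_real_affine[OF g, of "-1" x] by simp
  have int: "integrable (lborel \<Otimes>\<^sub>M lborel)
     (\<lambda>(x,z). exp (- \<i> * of_real (\<xi> * z)) * (f x * cnj (g (x - z))))" for \<xi>
  proof (rule lborel_pair.Fubini_integrable)
    show "integrable lborel (\<lambda>x. LINT z|lborel. cmod (case (x,z) of (x,z) \<Rightarrow> exp (- \<i> * of_real (\<xi> * z)) * (f x * cnj (g (x - z)))))"
      using f by (simp add: norm_mult shift'[of "\<lambda>z. cmod (g z)"])
    have "integrable lborel (\<lambda>z. exp (- \<i> * of_real (\<xi> * z)) * (f x * cnj (g (x - z))))" for x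
      by (rule Bochner_Integration.integrable_bound[OF integrable_mult_right[OF shifti[of x], of "f x"]])
         (auto simp: norm_mult)
    then show "AE x in lborel. integrable lborel (\<lambda>z. case (x,z) of (x,z) \<Rightarrow> exp (- \<i> * of_real (\<xi> * z)) * (f x * cnj (g (x - z))))"
      by simp
  qed measurable
  have "h 0 = 0"
  proof (rule fourier_zero_imp_zero)
    \<comment> \<open>Integrability of the correlation is the joint integrability \<open>int\<close>
      at frequency 0.\<close>
    have "integrable lborel (\<lambda>z. LINT x|lborel. f x * cnj (g (x - z)))"
      using lborel_pair.integrable_snd[OF int[of 0]] by simp
    then show hi: "integrable lborel h" by (simp add: h_def[abs_def])
    have intx: "integrable lborel (\<lambda>x. f x * cnj (g (x - z)))" for z
      by (rule Bochner_Integration.integrable_bound[OF integrable_mult_right[OF f, of "complex_of_real G"]])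
         (auto simp: norm_mult mult.commute[of "\<bar>G\<bar>"] intro!: AE_I2 mult_left_mono order_trans[OF bd])
    show "cmod (h z) \<le> (LINT x|lborel. cmod (f x) * G)" for z
      unfolding h_def
      by (rule Bochner_Integration.integral_norm_bound_integral)
         (use intx f bd in \<open>auto simp: norm_mult intro!: mult_left_mono\<close>)
    show "isCont h 0"
      unfolding continuous_at_sequentially
    proof (intro allI impI)
      fix X :: "nat \<Rightarrow> real" assume X: "X \<longlonglongrightarrow> 0"
      show "(h \<circ> X) \<longlonglongrightarrow> h 0"
        unfolding h_def comp_def
      proof (rule integral_dominated_convergence[where w="\<lambda>x. cmod (f x) * G"])
        show "AE x in lborel. (\<lambda>n. f x * cnj (g (x - X n))) \<longlonglongrightarrow> f x * cnj (g (x - 0))"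
        proof (rule AE_I2)
          fix x
          have "(\<lambda>n. x - X n) \<longlonglongrightarrow> x - 0" by (intro tendsto_intros X)
          moreover have "isCont g (x - 0)" using contg by (simp add: continuous_on_eq_continuous_at)
          ultimately show "(\<lambda>n. f x * cnj (g (x - X n))) \<longlonglongrightarrow> f x * cnj (g (x - 0))"
            by (intro tendsto_mult tendsto_cnj tendsto_const isCont_tendsto_compose[of _ g])
        qed
      qed (use f bd in \<open>auto simp: norm_mult intro!: mult_left_mono\<close>)
    qed
    show "fourier h \<xi> = 0" for \<xi>
    proof -
      have [measurable]: "h \<in> borel_measurable borel" using hi by auto
      have "fourier h \<xi> = (LINT z|lborel. LINT x|lborel. exp (- \<i> * of_real (\<xi> * z)) * (f x * cnj (g (x - z))))"
        by (subst fourier_eq_lborel) (simp_all add: h_def intx)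
      also have "\<dots> = (LINT x|lborel. LINT z|lborel. exp (- \<i> * of_real (\<xi> * z)) * (f x * cnj (g (x - z))))"
        using lborel_pair.Fubini_integral[OF int[of \<xi>]] by simp
      also have "\<dots> = (LINT x|lborel. (exp (- \<i> * of_real (\<xi> * x)) * f x) * cnj (fourier g \<xi>))"
      proof (rule Bochner_Integration.integral_cong[OF refl])
        fix x
        \<comment> \<open>Writing z = x - (x - z) in the phase separates the transforms: the factor
          in \<open>x\<close> leaves the inner integral, which after replacing x - z by z is the
          conjugate of \<open>fourier g\<close>.\<close>
        have "exp (- \<i> * of_real (\<xi> * z)) * (f x * cnj (g (x - z)))
          = exp (- \<i> * of_real (\<xi> * x)) * f x * cnj (exp (- \<i> * of_real (\<xi> * (x - z))) * g (x - z))" for z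
          by (simp add: exp_cnj exp_minus exp_diff right_diff_distrib field_simps)
        then have "(LINT z|lborel. exp (- \<i> * of_real (\<xi> * z)) * (f x * cnj (g (x - z))))
           = (LINT z|lborel. exp (- \<i> * of_real (\<xi> * x)) * f x * cnj (exp (- \<i> * of_real (\<xi> * (x - z))) * g (x - z)))"
          by (simp only:)
        also have "\<dots> = (LINT z|lborel. exp (- \<i> * of_real (\<xi> * x)) * f x * cnj (exp (- \<i> * of_real (\<xi> * z)) * g z))"
          by (rule shift[of "\<lambda>z. exp (- \<i> * of_real (\<xi> * x)) * f x * cnj (exp (- \<i> * of_real (\<xi> * z)) * g z)"])
        also have "\<dots> = exp (- \<i> * of_real (\<xi> * x)) * f x * cnj (LINT z|lborel. exp (- \<i> * of_real (\<xi> * z)) * g z)"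
          by (simp only: integral_mult_right_zero Bochner_Integration.integral_cnj)
        finally show "(LINT z|lborel. exp (- \<i> * of_real (\<xi> * z)) * (f x * cnj (g (x - z))))
           = (exp (- \<i> * of_real (\<xi> * x)) * f x) * cnj (fourier g \<xi>)"
          by (simp add: fourier_eq_lborel)
      qed
      also have "\<dots> = fourier f \<xi> * cnj (fourier g \<xi>)"
        by (simp add: fourier_eq_lborel)
      finally show ?thesis using F[of \<xi>] by auto
    qed
  qed
  then show ?thesis by (simp add: h_def L2_inner_eq_lborel)
qed

subsection \<open>Decay and interaction of wave packets\<close>

declare wave_packet.simps [simp del]

section \<open>A slowly varying integrable weight\<close>

definition weight :: "real \<Rightarrow> real" where
  "weight x = 1 / (1 + x\<^sup>2)"

lemma weight_pos: "0 < weight x"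
  by (simp add: weight_def add_pos_nonneg)

lemma weight_nonneg: "0 \<le> weight x"
  using weight_pos[of x] by simp

lemma weight_le_1: "weight x \<le> 1"
  by (simp add: weight_def add_pos_nonneg)

lemma continuous_weight: "continuous_on UNIV weight"
  unfolding weight_def[abs_def]
  by (intro continuous_intros) (simp add: add_nonneg_eq_0_iff)

lemma borel_measurable_weight [measurable]: "weight \<in> borel_measurable borel"
  by (rule borel_measurable_continuous_onI) (rule continuous_weight)

lemma weight_minus: "weight (- x) = weight x"
  by (simp add: weight_def)

text \<open>A Peetre-type inequality: after clearing denominators, the difference of the two sides
  is a sum of squares. A shift by \<open>b\<close> thus costs at most a factor quadratic in
  \<open>b\<close>.\<close>

lemma weight_add_le: "weight (a + b) \<le> 2 * (1 + b\<^sup>2) * weight a"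
proof -
  have "0 \<le> (a + 2 * b)\<^sup>2 + 2 * ((a + b) * b)\<^sup>2 + 1" by simp
  also have "\<dots> = 2 * (1 + b\<^sup>2) * (1 + (a + b)\<^sup>2) - (1 + a\<^sup>2)"
    by (simp add: power2_eq_square algebra_simps)
  finally have "1 + a\<^sup>2 \<le> 2 * (1 + b\<^sup>2) * (1 + (a + b)\<^sup>2)" by simp
  moreover have "0 < 1 + a\<^sup>2" "0 < 1 + (a + b)\<^sup>2" by (simp_all add: add_pos_nonneg)
  ultimately show ?thesis by (simp add: weight_def divide_simps)
qed

lemma integrable_weight: "integrable lborel weight"
  using integrable_inverse_1_plus_square
  by (simp add: set_integrable_def weight_def[abs_def] inverse_eq_divide)

definition weight_mass :: real where
  "weight_mass = (LINT x|lborel. weight x)"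

lemma weight_mass_nonneg: "0 \<le> weight_mass"
  unfolding weight_mass_def by (intro Bochner_Integration.integral_nonneg weight_nonneg)

lemma integrable_weight_affine:
  assumes "t > 0" shows "integrable lborel (\<lambda>x. weight ((x - y) / t))"
  using lborel_integrable_real_affine[OF integrable_weight, of "1/t" "-y/t"] assms
  by (simp add: diff_divide_distrib)

lemma integral_weight_affine:
  assumes "t > 0" shows "(LINT x|lborel. weight ((x - y) / t)) = t * weight_mass"
proof -
  have mass: "weight_mass = (1 / t) * (LINT x|lborel. weight ((x - y) / t))"
    using lborel_integral_real_affine[of "1/t" weight "-y/t"] assms
    by (simp add: diff_divide_distrib weight_mass_def)
  show ?thesis unfolding mass using assms by simp
qed

lemma schwartz_continuous:
  assumes "schwartz f" shows "continuous_on UNIV f"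
proof -
  have "nth_deriv 0 f differentiable (at x)" for x
    using assms by (simp add: schwartz_def)
  then show ?thesis
    by (simp add: nth_deriv_def continuous_on_eq_continuous_at differentiable_imp_continuous_within)
qed

text \<open>Expanding (1 + x^2)^2 reduces the bound to the moments of order 0, 2 and 4. The square
  provides two factors of the weight: one pays for the loss in \<open>weight_add_le\<close>, the
  other is integrated.\<close>

lemma schwartz_decay:
  assumes "schwartz f"
  obtains M where "M > 0" "\<And>x. cmod (f x) \<le> M * (weight x)\<^sup>2"
proof -
  have "bounded (range (\<lambda>x. x ^ m *\<^sub>R nth_deriv 0 f x))" for m
    using assms unfolding schwartz_def by blast
  then have "\<exists>B. \<forall>x. \<bar>x\<bar> ^ m * cmod (f x) \<le> B" for m
    by (simp add: nth_deriv_def bounded_iff power_abs)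
  then obtain B where B: "\<And>m x. \<bar>x\<bar> ^ m * cmod (f x) \<le> B m"
    by metis
  define M where "M = 1 + \<bar>B 0\<bar> + 2 * \<bar>B 2\<bar> + \<bar>B 4\<bar>"
  show thesis
  proof
    show "M > 0" by (simp add: M_def)
    fix x :: real
    have pos: "0 < 1 + x\<^sup>2" by (simp add: add_pos_nonneg)
    have "(1 + x\<^sup>2)\<^sup>2 * cmod (f x) = \<bar>x\<bar>^0 * cmod (f x) + 2 * (\<bar>x\<bar>^2 * cmod (f x)) + \<bar>x\<bar>^4 * cmod (f x)"
      by (simp add: power2_eq_square algebra_simps power4_eq_xxxx)
    also have "\<dots> \<le> M" unfolding M_def using B[of x 0] B[of x 2] B[of x 4] by linarith
    finally have "(1 + x\<^sup>2)\<^sup>2 * cmod (f x) \<le> M" .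
    then show "cmod (f x) \<le> M * (weight x)\<^sup>2"
      by (simp add: weight_def power_one_over pos_le_divide_eq[OF zero_less_power[OF pos]] mult.commute)
  qed
qed

section \<open>Size, Fourier localization and inner products of single packets\<close>

context
  fixes \<phi> :: "real \<Rightarrow> complex" and M :: real
  assumes cont: "continuous_on UNIV \<phi>" and M: "M > 0"
    and decay: "\<And>x. cmod (\<phi> x) \<le> M * (weight x)\<^sup>2"
begin

lemma wave_packet_bound:
  assumes "t > 0"
  shows "cmod (wave_packet \<phi> (y, \<eta>, t) x) \<le> M / t * (weight ((x - y) / t))\<^sup>2"
proof -
  have "weight ((y - x) / t) = weight ((x - y) / t)"
    using weight_minus[of "(x - y) / t"] by (simp add: minus_divide_left)
  then show ?thesis
    using decay[of "(y - x) / t"] assms by (simp add: wave_packet.simps norm_mult norm_divide divide_right_mono)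
qed

lemma wave_packet_bound_weight:
  assumes "t > 0"
  shows "cmod (wave_packet \<phi> (y, \<eta>, t) x) \<le> M / t * weight ((x - y) / t)"
proof -
  have "(weight ((x - y) / t))\<^sup>2 \<le> weight ((x - y) / t)"
    using weight_le_1[of "(x - y) / t"] weight_nonneg[of "(x - y) / t"]
    by (simp add: power2_eq_square mult_left_le)
  then show ?thesis
    using M assms by (intro order_trans[OF wave_packet_bound[OF assms]] mult_left_mono) auto
qed

lemma wave_packet_bounded:
  assumes "t > 0"
  shows "cmod (wave_packet \<phi> (y, \<eta>, t) x) \<le> M / t"
  using wave_packet_bound_weight[OF assms, of y \<eta> x] weight_le_1[of "(x - y) / t"] M assms
    mult_left_mono[of "weight ((x - y) / t)" 1 "M / t"] by auto

lemma continuous_wave_packet: "continuous_on UNIV (wave_packet \<phi> (y, \<eta>, t))"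
proof -
  have "continuous_on UNIV (\<lambda>x. (y - x) / t)"
    unfolding divide_inverse by (intro continuous_on_mult continuous_on_diff continuous_on_const continuous_on_id)
  then have "continuous_on UNIV (\<lambda>x. \<phi> ((y - x) / t))"
    by (rule continuous_on_compose2[OF cont]) simp
  then have cont': "continuous_on UNIV (\<lambda>x. exp (- \<i> * of_real (\<eta> * (y - x))) * c * cnj (\<phi> ((y - x) / t)))" for c
    by (intro continuous_on_mult continuous_on_cnj continuous_on_exp continuous_on_const
        continuous_on_of_real continuous_on_diff continuous_on_id)
  have eq: "wave_packet \<phi> (y, \<eta>, t) = (\<lambda>x. exp (- \<i> * of_real (\<eta> * (y - x))) * of_real (1 / t) * cnj (\<phi> ((y - x) / t)))"
    by (rule ext) (rule wave_packet.simps)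
  show ?thesis unfolding eq by (rule cont')
qed

lemma borel_measurable_wave_packet [measurable]: "wave_packet \<phi> (y, \<eta>, t) \<in> borel_measurable borel"
  by (rule borel_measurable_continuous_onI) (rule continuous_wave_packet)

lemma integrable_wave_packet:
  assumes "t > 0"
  shows "integrable lborel (wave_packet \<phi> (y, \<eta>, t))"
proof (rule Bochner_Integration.integrable_bound)
  show "integrable lborel (\<lambda>x. M / t * weight ((x - y) / t))"
    by (intro integrable_mult_right integrable_weight_affine assms)
  show "AE x in lborel. norm (wave_packet \<phi> (y, \<eta>, t) x) \<le> norm (M / t * weight ((x - y) / t))"
    unfolding real_norm_def
    by (intro AE_I2 order_trans[OF wave_packet_bound_weight[OF assms] abs_ge_self])
qed measurable

lemma in_L2_wave_packet:
  assumes "t > 0"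
  shows "in_L2 (wave_packet \<phi> (y, \<eta>, t))"
proof -
  have "integrable lborel (\<lambda>x. (cmod (wave_packet \<phi> (y, \<eta>, t) x))\<^sup>2)"
  proof (rule Bochner_Integration.integrable_bound)
    show "integrable lborel (\<lambda>x. M / t * wave_packet \<phi> (y, \<eta>, t) x)"
      using integrable_wave_packet[OF assms] by simp
    show "AE x in lborel. norm ((cmod (wave_packet \<phi> (y, \<eta>, t) x))\<^sup>2)
       \<le> norm (complex_of_real (M / t) * wave_packet \<phi> (y, \<eta>, t) x)"
      using wave_packet_bounded[OF assms, of y \<eta>] M assms
      by (auto simp only: norm_mult norm_of_real power2_eq_square abs_mult abs_norm_cancel real_norm_def
            intro!: AE_I2 mult_right_mono norm_ge_zero order_trans[OF _ abs_ge_self])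
  qed measurable
  then show ?thesis
    unfolding in_L2_def by (auto intro!: integrable_completion[THEN iffD2] measurable_completion)
qed

text \<open>The substitution x = y - t u cancels the factor 1/t. The result localizes the packet in
  frequency around \<eta> with width of order 1/t.\<close>

lemma fourier_wave_packet:
  assumes t: "t > 0"
  shows "fourier (wave_packet \<phi> (y, \<eta>, t)) \<xi> = exp (- \<i> * of_real (\<xi> * y)) * cnj (fourier \<phi> (t * (\<xi> - \<eta>)))"
proof -
  have "\<phi> \<in> borel_measurable borel"
    by (rule borel_measurable_continuous_onI) (rule cont)
  have "fourier (wave_packet \<phi> (y, \<eta>, t)) \<xi>
    = t *\<^sub>R (LINT u|lborel. exp (- \<i> * of_real (\<xi> * (y - t * u))) * wave_packet \<phi> (y, \<eta>, t) (y - t * u))"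
    using lborel_integral_real_affine[of "-t" "\<lambda>x. exp (- \<i> * of_real (\<xi> * x)) * wave_packet \<phi> (y, \<eta>, t) x" y] t
    by (simp add: fourier_eq_lborel)
  also have "\<dots> = (LINT u|lborel. of_real t * (exp (- \<i> * of_real (\<xi> * (y - t * u))) * wave_packet \<phi> (y, \<eta>, t) (y - t * u)))"
    by (simp only: integral_mult_right_zero scaleR_conv_of_real)
  also have "\<dots> = (LINT u|lborel. exp (- \<i> * of_real (\<xi> * y)) * cnj (exp (- \<i> * of_real (t * (\<xi> - \<eta>) * u)) * \<phi> u))"
  proof (intro Bochner_Integration.integral_cong refl)
    fix u
    have "exp (- \<i> * of_real (\<xi> * (y - t * u))) * exp (- \<i> * of_real (\<eta> * (t * u)))
      = exp (- \<i> * of_real (\<xi> * y)) * exp (\<i> * of_real (t * (\<xi> - \<eta>) * u))"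
      unfolding exp_add[symmetric] by (simp add: algebra_simps)
    then show "of_real t * (exp (- \<i> * of_real (\<xi> * (y - t * u))) * wave_packet \<phi> (y, \<eta>, t) (y - t * u))
      = exp (- \<i> * of_real (\<xi> * y)) * cnj (exp (- \<i> * of_real (t * (\<xi> - \<eta>) * u)) * \<phi> u)"
      using t by (simp add: wave_packet.simps exp_cnj del: of_real_mult of_real_diff)
  qed
  also have "\<dots> = exp (- \<i> * of_real (\<xi> * y)) * cnj (fourier \<phi> (t * (\<xi> - \<eta>)))"
    by (simp only: integral_mult_right_zero Bochner_Integration.integral_cnj) (simp only: fourier_eq_lborel[OF \<open>\<phi> \<in> borel_measurable borel\<close>])
  finally show ?thesis .
qed

text \<open>The transform of a packet vanishes outside the open interval of radius \<delta> / t
  around its frequency, and a nonzero inner product forces two such intervals to meet.\<close>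

lemma wave_packet_orthogonal:
  assumes t: "t > 0" "t' > 0" and supp: "supp (fourier \<phi>) \<subseteq> {-\<delta><..<\<delta>}"
    and ne: "L2_inner (wave_packet \<phi> (y, \<eta>, t)) (wave_packet \<phi> (y', \<eta>', t')) \<noteq> 0"
  shows "\<bar>\<eta> - \<eta>'\<bar> < \<delta> / t + \<delta> / t'"
proof -
  have loc: "\<bar>\<xi> - \<eta>\<bar> < \<delta> / t" if "fourier (wave_packet \<phi> (y, \<eta>, t)) \<xi> \<noteq> 0" "t > 0" for y \<eta> t \<xi>
  proof -
    have "t * (\<xi> - \<eta>) \<in> supp (fourier \<phi>)"
      unfolding supp_def using that by (intro subsetD[OF closure_subset]) (simp add: fourier_wave_packet)
    with supp have "t * (\<xi> - \<eta>) \<in> {-\<delta><..<\<delta>}" by auto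
    then show ?thesis using that(2) by (auto simp: field_simps abs_less_iff)
  qed
  have "\<exists>\<xi>. fourier (wave_packet \<phi> (y, \<eta>, t)) \<xi> \<noteq> 0 \<and> fourier (wave_packet \<phi> (y', \<eta>', t')) \<xi> \<noteq> 0"
    using ne L2_inner_eq_0_if_fourier_disjoint[OF integrable_wave_packet[OF t(1)] integrable_wave_packet[OF t(2)]
        continuous_wave_packet wave_packet_bounded[OF t(2)]] by blast
  then obtain \<xi> where "\<bar>\<xi> - \<eta>\<bar> < \<delta> / t" "\<bar>\<xi> - \<eta>'\<bar> < \<delta> / t'" using loc t by blast
  then show ?thesis by linarith
qed

text \<open>The fine packet lives near y' at scale at most t, so the coarse packet can be replaced
  by its decay at y'. One weight factor of the fine packet pays for this; integrating the other
  gives t', which cancels the normalization 1/t'.\<close>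

lemma wave_packet_gram_bound:
  assumes t: "t' > 0" "t' \<le> t"
  shows "cmod (L2_inner (wave_packet \<phi> (y, \<eta>, t)) (wave_packet \<phi> (y', \<eta>', t')))
    \<le> 2 * M\<^sup>2 * weight_mass / t * weight ((y' - y) / t)"
proof -
  have t0: "t > 0" using t by simp
  let ?K = "2 * M\<^sup>2 / (t * t') * weight ((y' - y) / t)"
  have bound: "cmod (wave_packet \<phi> (y, \<eta>, t) x * cnj (wave_packet \<phi> (y', \<eta>', t') x)) \<le> ?K * weight ((x - y') / t')" for x
  proof -
    define u where "u = (x - y') / t'"
    have "((x - y') / t)\<^sup>2 \<le> u\<^sup>2"
      unfolding u_def power_divide using t t0 by (intro divide_left_mono power_mono) auto
    then have "(1 + ((x - y') / t)\<^sup>2) * weight u \<le> 1"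
      by (simp add: weight_def add_pos_nonneg)
    moreover have "weight ((x - y) / t) \<le> 2 * (1 + ((x - y') / t)\<^sup>2) * weight ((y' - y) / t)"
      using weight_add_le[of "(y' - y) / t" "(x - y') / t"] by (simp add: add_divide_distrib[symmetric])
    ultimately have "weight ((x - y) / t) * weight u \<le> 2 * weight ((y' - y) / t)"
      using weight_nonneg[of u] weight_nonneg[of "(y' - y) / t"]
        mult_right_mono[of "weight ((x - y) / t)" "2 * (1 + ((x - y') / t)\<^sup>2) * weight ((y' - y) / t)" "weight u"]
        mult_left_mono[of "(1 + ((x - y') / t)\<^sup>2) * weight u" 1 "2 * weight ((y' - y) / t)"]
      by (simp add: algebra_simps)
    moreover have "0 \<le> M\<^sup>2 / (t * t') * weight u"
      using t t0 weight_nonneg[of u] by simp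
    ultimately have "(M / t * weight ((x - y) / t)) * (M / t' * (weight u)\<^sup>2)
        \<le> M\<^sup>2 / (t * t') * (2 * weight ((y' - y) / t)) * weight u"
      using mult_left_mono[of "weight ((x - y) / t) * weight u" "2 * weight ((y' - y) / t)" "M\<^sup>2 / (t * t') * weight u"]
        by (simp add: power2_eq_square mult_ac)
    then show ?thesis
      unfolding norm_mult complex_mod_cnj
      using mult_mono[OF wave_packet_bound_weight[OF t0, of y \<eta> x] wave_packet_bound[OF t(1), of y' \<eta>' x]]
        M t0 weight_nonneg[of "(x - y) / t"]
      by (simp add: u_def mult_ac)
  qed
  have "cmod (L2_inner (wave_packet \<phi> (y, \<eta>, t)) (wave_packet \<phi> (y', \<eta>', t')))
    \<le> (LINT x|lborel. ?K * weight ((x - y') / t'))"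
    unfolding L2_inner_eq_lborel[OF borel_measurable_wave_packet borel_measurable_wave_packet]
  proof (rule Bochner_Integration.integral_norm_bound_integral)
    show "integrable lborel (\<lambda>x. ?K * weight ((x - y') / t'))"
      by (intro integrable_mult_right integrable_weight_affine t)
    then show "integrable lborel (\<lambda>x. wave_packet \<phi> (y, \<eta>, t) x * cnj (wave_packet \<phi> (y', \<eta>', t') x))"
    proof (rule Bochner_Integration.integrable_bound)
      show "AE x in lborel. norm (wave_packet \<phi> (y, \<eta>, t) x * cnj (wave_packet \<phi> (y', \<eta>', t') x))
          \<le> norm (?K * weight ((x - y') / t'))"
        unfolding real_norm_def by (intro AE_I2 order_trans[OF bound abs_ge_self])
    qed measurable
  qed (rule bound)
  also have "\<dots> = ?K * (t' * weight_mass)"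
    by (simp add: integral_weight_affine t)
  also have "\<dots> = 2 * M\<^sup>2 * weight_mass / t * weight ((y' - y) / t)"
    using t by simp
  finally show ?thesis .
qed

end

text \<open>On the interval of radius \<open>\<alpha> * \<tau> i / 2\<close> around \<open>p i\<close> the weight is
  comparable to its value at \<open>p i\<close>, and these intervals are disjoint.\<close>

lemma weight_packing:
  fixes p \<tau> :: "'i \<Rightarrow> real"
  assumes fin: "finite L" and \<alpha>: "\<alpha> > 0"
    and \<tau>: "\<And>i. i \<in> L \<Longrightarrow> 0 < \<tau> i" "\<And>i. i \<in> L \<Longrightarrow> \<tau> i \<le> t"
    and t: "t > 0"
    and sep: "\<And>i j. i \<in> L \<Longrightarrow> j \<in> L \<Longrightarrow> i \<noteq> j \<Longrightarrow> \<alpha> * max (\<tau> i) (\<tau> j) < \<bar>p i - p j\<bar>"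
  shows "(\<Sum>i\<in>L. \<tau> i * weight ((p i - y) / t)) \<le> 2 * (1 + (\<alpha> / 2)\<^sup>2) / \<alpha> * weight_mass * t"
proof -
  define I where "I i = {p i - \<alpha> * \<tau> i / 2 .. p i + \<alpha> * \<tau> i / 2}" for i
  \<comment> \<open>The loss in \<open>weight_add_le\<close> for a shift by \<alpha> / 2: in units
    of \<open>t\<close>, points of \<open>I i\<close> are no further than that from
    \<open>p i\<close>, because \<tau> i \<le> t.\<close>
  define K where "K = 2 * (1 + (\<alpha> / 2)\<^sup>2)"
  have K: "K > 0" unfolding K_def by (simp add: add_pos_nonneg)
  let ?g = "\<lambda>x. weight ((x - y) / t)"
  have gi: "integrable lborel ?g" by (rule integrable_weight_affine[OF t])
  have disj: "disjoint_family_on I L"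
    unfolding disjoint_family_on_def
  proof (intro ballI impI, rule ccontr)
    fix i j assume ij: "i \<in> L" "j \<in> L" "i \<noteq> j" and "I i \<inter> I j \<noteq> {}"
    then obtain x where x: "x \<in> I i" "x \<in> I j" by blast
    have "\<bar>p i - p j\<bar> \<le> \<alpha> * \<tau> i / 2 + \<alpha> * \<tau> j / 2"
      using x unfolding I_def by (simp add: abs_le_iff)
    also have "\<dots> \<le> \<alpha> * max (\<tau> i) (\<tau> j)"
      using \<alpha> mult_left_mono[of "\<tau> i" "max (\<tau> i) (\<tau> j)" \<alpha>] mult_left_mono[of "\<tau> j" "max (\<tau> i) (\<tau> j)" \<alpha>]
      by linarith
    finally show False using sep[OF ij] by simp
  qed
  have ind_int: "integrable lborel (\<lambda>x. indicator (I i) x * ?g x)" for i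
    by (rule Bochner_Integration.integrable_bound[OF gi])
       (auto simp: I_def indicator_def weight_nonneg)
  have comp: "\<alpha> * (\<tau> i * weight ((p i - y) / t)) \<le> K * (LINT x|lborel. indicator (I i) x * ?g x)" if i: "i \<in> L" for i
  proof -
    have pt: "indicator (I i) x * weight ((p i - y) / t) \<le> K * (indicator (I i) x * ?g x)" for x
    proof (cases "x \<in> I i")
      case True
      then have "\<bar>p i - x\<bar> \<le> \<alpha> / 2 * \<tau> i" unfolding I_def by (simp only: atLeastAtMost_iff abs_le_iff) linarith
      also have "\<dots> \<le> \<alpha> / 2 * t" using \<alpha> \<tau>[OF i] by simp
      finally have "\<bar>(p i - x) / t\<bar> \<le> \<alpha> / 2" using t by (simp add: divide_le_eq)
      from power_mono[OF this abs_ge_zero, of 2] have "((p i - x) / t)\<^sup>2 \<le> (\<alpha> / 2)\<^sup>2"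
        by (simp only: power2_abs)
      then have "2 * (1 + ((p i - x) / t)\<^sup>2) * ?g x \<le> K * ?g x"
        unfolding K_def by (intro mult_right_mono) (auto simp: weight_nonneg)
      moreover have "weight ((p i - y) / t) \<le> 2 * (1 + ((p i - x) / t)\<^sup>2) * ?g x"
        using weight_add_le[of "(x - y) / t" "(p i - x) / t"] by (simp add: add_divide_distrib[symmetric])
      ultimately show ?thesis using True by simp
    qed simp
    \<comment> \<open>The factor \<alpha> * \<tau> i is the length of \<open>I i\<close>.\<close>
    have "\<alpha> * (\<tau> i * weight ((p i - y) / t)) = (LINT x|lborel. indicator (I i) x * weight ((p i - y) / t))"
      using \<alpha> \<tau>[OF i] by (simp add: I_def field_simps)
    also have "\<dots> \<le> (LINT x|lborel. K * (indicator (I i) x * ?g x))"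
    proof (rule integral_mono)
      show "integrable lborel (\<lambda>x. indicator (I i) x * weight ((p i - y) / t))"
        by (intro integrable_mult_left integrable_real_indicator) (auto simp: I_def emeasure_lborel_Icc_eq)
      show "integrable lborel (\<lambda>x. K * (indicator (I i) x * ?g x))"
        by (intro integrable_mult_right ind_int)
    qed (rule pt)
    finally show ?thesis by simp
  qed
  have "\<alpha> * (\<Sum>i\<in>L. \<tau> i * weight ((p i - y) / t)) \<le> (\<Sum>i\<in>L. K * (LINT x|lborel. indicator (I i) x * ?g x))"
    unfolding sum_distrib_left by (intro sum_mono comp)
  also have "\<dots> = K * (LINT x|lborel. (\<Sum>i\<in>L. indicator (I i) x * ?g x))"
    by (simp add: Bochner_Integration.integral_sum ind_int sum_distrib_left)
  also have "\<dots> \<le> K * (LINT x|lborel. ?g x)"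
  proof (intro mult_left_mono integral_mono gi)
    show "integrable lborel (\<lambda>x. \<Sum>i\<in>L. indicator (I i) x * ?g x)"
      by (intro Bochner_Integration.integrable_sum ind_int)
    \<comment> \<open>By disjointness the indicators add up to that of the union, which is at most
      1.\<close>
    show "(\<Sum>i\<in>L. indicator (I i) x * ?g x) \<le> ?g x" for x
      unfolding sum_distrib_right[symmetric] indicator_UN_disjoint[OF fin disj, symmetric]
      by (simp add: indicator_def weight_nonneg)
  qed (use K in simp)
  also have "\<dots> = K * (t * weight_mass)"
    by (simp only: integral_weight_affine[OF t])
  finally show ?thesis using \<alpha> by (simp add: K_def field_simps)
qed

subsection \<open>Bessel inequality for comparable coefficients\<close>

lemma in_L2_measurable: "in_L2 f \<Longrightarrow> f \<in> borel_measurable lebesgue"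
  by (simp add: in_L2_def)

text \<open>The sum of the squares dominates the product. Members of L^2 are only assumed Lebesgue
  measurable, so the integrals here stay over \<open>lebesgue\<close>.\<close>

lemma in_L2_integrable_mult:
  assumes f: "in_L2 f" and g: "in_L2 g"
  shows "integrable lebesgue (\<lambda>x. f x * cnj (g x))"
proof (rule Bochner_Integration.integrable_bound)
  show "integrable lebesgue (\<lambda>x. (cmod (f x))\<^sup>2 + (cmod (g x))\<^sup>2)"
    using f g by (simp add: in_L2_def)
  note [measurable] = in_L2_measurable[OF f] in_L2_measurable[OF g]
  show "(\<lambda>x. f x * cnj (g x)) \<in> borel_measurable lebesgue" by measurable
  have "a * b \<le> a\<^sup>2 + b\<^sup>2" if "0 \<le> a" "0 \<le> b" for a b :: real
    using sum_squares_bound[of a b] mult_nonneg_nonneg[OF that] by linarith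
  then show "AE x in lebesgue. norm (f x * cnj (g x)) \<le> norm ((cmod (f x))\<^sup>2 + (cmod (g x))\<^sup>2)"
    by (auto simp: norm_mult)
qed

lemma L2_inner_commute: "L2_inner g f = cnj (L2_inner f g)"
  unfolding L2_inner_def Bochner_Integration.integral_cnj[symmetric] by (simp add: mult.commute)

lemma L2_norm_nonneg: "0 \<le> L2_norm f"
  by (simp add: L2_norm_def)

lemma L2_inner_self: "L2_inner f f = of_real ((L2_norm f)\<^sup>2)"
proof -
  have "L2_inner f f = (LINT x|lebesgue. complex_of_real ((cmod (f x))\<^sup>2))"
    unfolding L2_inner_def by (simp only: complex_norm_square)
  also have "\<dots> = of_real ((L2_norm f)\<^sup>2)"
    unfolding integral_complex_of_real L2_norm_def by simp
  finally show ?thesis .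
qed

text \<open>The right side is the squared norm of f - sum c_i g_i, obtained by integrating a
  pointwise identity.\<close>

lemma L2_bessel_expand:
  assumes f: "in_L2 f" and g: "\<And>i. i \<in> F \<Longrightarrow> in_L2 (g i)"
  shows "0 \<le> (L2_norm f)\<^sup>2 - 2 * Re (\<Sum>i\<in>F. cnj (c i) * L2_inner f (g i))
     + Re (\<Sum>i\<in>F. \<Sum>j\<in>F. c i * cnj (c j) * L2_inner (g i) (g j))"
proof -
  define H1 where "H1 x = (\<Sum>i\<in>F. cnj (c i) * (f x * cnj (g i x)))" for x
  define H2 where "H2 x = (\<Sum>i\<in>F. \<Sum>j\<in>F. c i * cnj (c j) * (g i x * cnj (g j x)))" for x
  have i0: "integrable lebesgue (\<lambda>x. f x * cnj (f x))" by (rule in_L2_integrable_mult[OF f f])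
  have i1: "integrable lebesgue H1" unfolding H1_def
    by (intro Bochner_Integration.integrable_sum integrable_mult_right in_L2_integrable_mult f g)
  have i2: "integrable lebesgue H2" unfolding H2_def
    by (intro Bochner_Integration.integrable_sum integrable_mult_right in_L2_integrable_mult g)
  have I1: "integral\<^sup>L lebesgue H1 = (\<Sum>i\<in>F. cnj (c i) * L2_inner f (g i))"
    unfolding H1_def L2_inner_def
    by (subst Bochner_Integration.integral_sum)
       (auto intro!: integrable_mult_right in_L2_integrable_mult f g sum.cong)
  have I2: "integral\<^sup>L lebesgue H2 = (\<Sum>i\<in>F. \<Sum>j\<in>F. c i * cnj (c j) * L2_inner (g i) (g j))"
    unfolding H2_def L2_inner_def
    by (subst Bochner_Integration.integral_sum, intro Bochner_Integration.integrable_sum integrable_mult_right in_L2_integrable_mult g, assumption+,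
        rule sum.cong[OF refl], subst Bochner_Integration.integral_sum)
       (auto intro!: integrable_mult_right in_L2_integrable_mult g sum.cong)
  have pt: "0 \<le> Re (f x * cnj (f x) - 2 * H1 x + H2 x)" for x
  proof -
    define s where "s = (\<Sum>i\<in>F. c i * g i x)"
    have h1: "H1 x = f x * cnj s"
      unfolding H1_def s_def cnj_sum sum_distrib_left by (rule sum.cong) (auto simp: mult_ac)
    have h2: "H2 x = s * cnj s"
      unfolding H2_def s_def cnj_sum sum_product by (intro sum.cong refl) (simp add: mult_ac)
    have "Re (f x * cnj (f x) - 2 * H1 x + H2 x) = Re ((f x - s) * cnj (f x - s))"
      unfolding h1 h2 by (simp add: algebra_simps)
    also have "\<dots> = (cmod (f x - s))\<^sup>2" by (simp only: complex_mult_cnj cmod_power2) simp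
    finally show ?thesis by simp
  qed
  have "0 \<le> (LINT x|lebesgue. Re (f x * cnj (f x) - 2 * H1 x + H2 x))"
    by (intro Bochner_Integration.integral_nonneg pt)
  also have "\<dots> = Re (LINT x|lebesgue. f x * cnj (f x) - 2 * H1 x + H2 x)"
    by (rule integral_Re) (intro Bochner_Integration.integrable_add Bochner_Integration.integrable_diff integrable_mult_right i0 i1 i2)
  also have "(LINT x|lebesgue. f x * cnj (f x) - 2 * H1 x + H2 x) = L2_inner f f - 2 * integral\<^sup>L lebesgue H1 + integral\<^sup>L lebesgue H2"
    using i0 i1 i2 by (simp add: L2_inner_def)
  finally show ?thesis by (simp add: I1 I2 L2_inner_self)
qed

text \<open>Comparability of the coefficients makes the one-sided row sums over \<open>\<tau> j \<le> \<tau> i\<close>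
  sufficient: half of the Gram form is estimated row by row, the other half by symmetry.\<close>

lemma L2_bessel_comparable:
  fixes \<tau> :: "'i \<Rightarrow> real"
  assumes fin: "finite F" and \<tau>: "\<And>i. i \<in> F \<Longrightarrow> 0 < \<tau> i"
    and f: "in_L2 f" and g: "\<And>i. i \<in> F \<Longrightarrow> in_L2 (g i)" and K: "K > 0"
    and a: "\<And>i j. i \<in> F \<Longrightarrow> j \<in> F \<Longrightarrow> cmod (L2_inner f (g i)) \<le> 2 * cmod (L2_inner f (g j))"
    and row: "\<And>i. i \<in> F \<Longrightarrow> (\<Sum>j\<in>{j\<in>F. \<tau> j \<le> \<tau> i}. \<tau> j * cmod (L2_inner (g i) (g j))) \<le> K"
  shows "(\<Sum>i\<in>F. \<tau> i * (cmod (L2_inner f (g i)))\<^sup>2) \<le> 4 * K * (L2_norm f)\<^sup>2"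
proof -
  define a where "a i = cmod (L2_inner f (g i))" for i
  define G where "G i j = cmod (L2_inner (g i) (g j))" for i j
  define D where "D = (\<Sum>i\<in>F. \<tau> i * (a i)\<^sup>2)"
  define q where "q i j = \<tau> i * a i * (\<tau> j * a j) * G i j" for i j
  \<comment> \<open>This value balances the expansion: the cross term is -2 r D and the quadratic
    form is at most 4 K r^2 D = r D, which leaves r D below the squared norm of
    \<open>f\<close>.\<close>
  define r where "r = 1 / (4 * K)"
  define c where "c i = of_real (r * \<tau> i) * L2_inner f (g i)" for i
  have a0: "0 \<le> a i" and G0: "0 \<le> G i j" for i j by (simp_all add: a_def G_def)
  have q0: "0 \<le> q i j" if "i \<in> F" "j \<in> F" for i j
    unfolding q_def using that \<tau> a0 G0 by (intro mult_nonneg_nonneg) (auto simp: less_imp_le)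
  have q_sym: "q i j = q j i" for i j
    unfolding q_def G_def by (simp add: L2_inner_commute[of "g i" "g j"] mult_ac)
  have half: "(\<Sum>i\<in>F. \<Sum>j\<in>F. if \<tau> j \<le> \<tau> i then q i j else 0) \<le> 2 * K * D"
  proof -
    have "(\<Sum>j\<in>F. if \<tau> j \<le> \<tau> i then q i j else 0) \<le> 2 * K * (\<tau> i * (a i)\<^sup>2)" if i: "i \<in> F" for i
    proof -
      have "(\<Sum>j\<in>F. if \<tau> j \<le> \<tau> i then q i j else 0) = (\<Sum>j\<in>{j\<in>F. \<tau> j \<le> \<tau> i}. q i j)"
        using fin by (simp add: sum.inter_filter)
      also have "\<dots> \<le> (\<Sum>j\<in>{j\<in>F. \<tau> j \<le> \<tau> i}. \<tau> i * a i * (2 * a i) * (\<tau> j * G i j))"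
      proof (rule sum_mono)
        fix j assume "j \<in> {j\<in>F. \<tau> j \<le> \<tau> i}"
        then have j: "j \<in> F" by simp
        \<comment> \<open>Comparability trades \<open>a j\<close> for \<open>2 * a i\<close>, after
          which only the row sum depends on \<open>j\<close>.\<close>
        have "\<tau> i * a i * (\<tau> j * G i j) * a j \<le> \<tau> i * a i * (\<tau> j * G i j) * (2 * a i)"
          using \<tau>[OF i] \<tau>[OF j] a0 G0 a[OF j i] by (intro mult_left_mono) (auto simp: a_def)
        then show "q i j \<le> \<tau> i * a i * (2 * a i) * (\<tau> j * G i j)"
          by (simp add: q_def mult_ac)
      qed
      also have "\<dots> \<le> \<tau> i * a i * (2 * a i) * K"
        unfolding sum_distrib_left[symmetric] using row[OF i] \<tau>[OF i] a0[of i]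
        by (intro mult_left_mono) (auto simp: G_def)
      finally show ?thesis by (simp add: power2_eq_square mult_ac)
    qed
    then show ?thesis unfolding D_def sum_distrib_left by (rule sum_mono)
  qed
  \<comment> \<open>Every pair is ordered one way or the other by scale (ties are counted twice),
    and \<open>q\<close> is symmetric and nonnegative, so twice the half sum dominates.\<close>
  have "(\<Sum>i\<in>F. \<Sum>j\<in>F. q i j)
     \<le> (\<Sum>i\<in>F. \<Sum>j\<in>F. (if \<tau> j \<le> \<tau> i then q i j else 0) + (if \<tau> i \<le> \<tau> j then q j i else 0))"
    by (intro sum_mono) (use q0 q_sym in auto)
  also have "\<dots> = (\<Sum>i\<in>F. \<Sum>j\<in>F. if \<tau> j \<le> \<tau> i then q i j else 0)
      + (\<Sum>j\<in>F. \<Sum>i\<in>F. if \<tau> i \<le> \<tau> j then q j i else 0)"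
    unfolding sum.distrib by (subst (2) sum.swap) (rule refl)
  also have "\<dots> \<le> 4 * K * D" using half by linarith
  finally have Q: "(\<Sum>i\<in>F. \<Sum>j\<in>F. q i j) \<le> 4 * K * D" .
  have "Re (\<Sum>i\<in>F. \<Sum>j\<in>F. c i * cnj (c j) * L2_inner (g i) (g j))
      \<le> cmod (\<Sum>i\<in>F. \<Sum>j\<in>F. c i * cnj (c j) * L2_inner (g i) (g j))"
    by (rule complex_Re_le_cmod)
  also have "\<dots> \<le> (\<Sum>i\<in>F. \<Sum>j\<in>F. r\<^sup>2 * q i j)"
  proof (intro sum_norm_le)
    fix i j assume "i \<in> F" "j \<in> F"
    then show "cmod (c i * cnj (c j) * L2_inner (g i) (g j)) \<le> r\<^sup>2 * q i j"
      using \<tau>[of i] \<tau>[of j] K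
      by (simp add: c_def q_def a_def G_def r_def norm_mult norm_divide power2_eq_square)
  qed
  also have "\<dots> = r\<^sup>2 * (\<Sum>i\<in>F. \<Sum>j\<in>F. q i j)" by (simp add: sum_distrib_left)
  also have "\<dots> \<le> r\<^sup>2 * (4 * K * D)" by (intro mult_left_mono Q) simp
  also have "\<dots> = r * D" using K by (simp add: r_def power2_eq_square)
  finally have quad: "Re (\<Sum>i\<in>F. \<Sum>j\<in>F. c i * cnj (c j) * L2_inner (g i) (g j)) \<le> r * D" .
  have "(\<Sum>i\<in>F. cnj (c i) * L2_inner f (g i)) = of_real (r * D)"
  proof -
    have "cnj (c i) * L2_inner f (g i) = of_real (r * (\<tau> i * (a i)\<^sup>2))" for i
      using complex_norm_square[of "L2_inner f (g i)"] by (simp add: c_def a_def mult_ac)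
    then show ?thesis by (simp add: D_def sum_distrib_left)
  qed
  then have "Re (\<Sum>i\<in>F. cnj (c i) * L2_inner f (g i)) = r * D"
    by (simp only: Re_complex_of_real)
  moreover have "0 \<le> (L2_norm f)\<^sup>2 - 2 * Re (\<Sum>i\<in>F. cnj (c i) * L2_inner f (g i))
     + Re (\<Sum>i\<in>F. \<Sum>j\<in>F. c i * cnj (c j) * L2_inner (g i) (g j))"
    by (rule L2_bessel_expand[OF f g])
  ultimately have "0 \<le> (L2_norm f)\<^sup>2 - r * D"
    using quad by linarith
  then show ?thesis using K by (simp add: r_def D_def a_def field_simps)
qed

subsection \<open>Dyadic decomposition\<close>

text \<open>Each dyadic band below \<open>A\<close> is a comparable family and costs
  \<open>K\<close>; what remains after \<open>J\<close> bands has coefficients at most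
  \<open>A / 2 ^ J\<close>.\<close>

lemma sum_dyadic_levels:
  fixes \<tau> a :: "'i \<Rightarrow> real"
  assumes fin: "finite F" and \<tau>: "\<And>i. i \<in> F \<Longrightarrow> 0 \<le> \<tau> i"
    and a0: "\<And>i. i \<in> F \<Longrightarrow> 0 \<le> a i" and aA: "\<And>i. i \<in> F \<Longrightarrow> a i \<le> A"
    and lev: "\<And>G. G \<subseteq> F \<Longrightarrow> (\<And>i j. i \<in> G \<Longrightarrow> j \<in> G \<Longrightarrow> a i \<le> 2 * a j) \<Longrightarrow> (\<Sum>i\<in>G. \<tau> i * (a i)\<^sup>2) \<le> K"
  shows "(\<Sum>i\<in>F. \<tau> i * (a i)\<^sup>2) \<le> real J * K + (A / 2 ^ J)\<^sup>2 * (\<Sum>i\<in>F. \<tau> i)"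
proof -
  \<comment> \<open>Induction on the number of bands; for \<open>J = 0\<close> the sum is empty
    since no coefficient exceeds \<open>A\<close>.\<close>
  have large: "(\<Sum>i\<in>{i\<in>F. A / 2 ^ J < a i}. \<tau> i * (a i)\<^sup>2) \<le> real J * K" for J
  proof (induction J)
    case 0
    have "{i\<in>F. A / 2 ^ 0 < a i} = {}" using aA by fastforce
    then show ?case by (simp only: sum.empty)
  next
    case (Suc J)
    let ?G = "{i\<in>F. A / 2 ^ Suc J < a i \<and> a i \<le> A / 2 ^ J}"
    have G: "(\<Sum>i\<in>?G. \<tau> i * (a i)\<^sup>2) \<le> K"
      by (rule lev) auto
    have "(\<Sum>i\<in>{i\<in>F. A / 2 ^ Suc J < a i}. \<tau> i * (a i)\<^sup>2)
      \<le> (\<Sum>i\<in>{i\<in>F. A / 2 ^ J < a i} \<union> ?G. \<tau> i * (a i)\<^sup>2)"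
      using fin \<tau> by (intro sum_mono2) auto
    also have "\<dots> = (\<Sum>i\<in>{i\<in>F. A / 2 ^ J < a i}. \<tau> i * (a i)\<^sup>2) + (\<Sum>i\<in>?G. \<tau> i * (a i)\<^sup>2)"
      using fin by (intro sum.union_disjoint) auto
    also have "\<dots> \<le> real J * K + K" using Suc G by simp
    finally show ?case by (simp add: algebra_simps)
  qed
  have small: "(\<Sum>i\<in>{i\<in>F. a i \<le> A / 2 ^ J}. \<tau> i * (a i)\<^sup>2) \<le> (A / 2 ^ J)\<^sup>2 * (\<Sum>i\<in>F. \<tau> i)"
  proof -
    have "(\<Sum>i\<in>{i\<in>F. a i \<le> A / 2 ^ J}. \<tau> i * (a i)\<^sup>2) \<le> (\<Sum>i\<in>{i\<in>F. a i \<le> A / 2 ^ J}. \<tau> i * (A / 2 ^ J)\<^sup>2)"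
      using \<tau> a0 by (intro sum_mono mult_left_mono power_mono) auto
    also have "\<dots> \<le> (\<Sum>i\<in>F. \<tau> i * (A / 2 ^ J)\<^sup>2)"
      using fin \<tau> by (intro sum_mono2) auto
    also have "\<dots> = (A / 2 ^ J)\<^sup>2 * (\<Sum>i\<in>F. \<tau> i)"
      unfolding sum_distrib_left by (intro sum.cong refl mult.commute)
    finally show ?thesis .
  qed
  have "(\<Sum>i\<in>F. \<tau> i * (a i)\<^sup>2) = (\<Sum>i\<in>{i\<in>F. A / 2 ^ J < a i} \<union> {i\<in>F. a i \<le> A / 2 ^ J}. \<tau> i * (a i)\<^sup>2)"
    by (rule sum.cong) auto
  also have "\<dots> = (\<Sum>i\<in>{i\<in>F. A / 2 ^ J < a i}. \<tau> i * (a i)\<^sup>2) + (\<Sum>i\<in>{i\<in>F. a i \<le> A / 2 ^ J}. \<tau> i * (a i)\<^sup>2)"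
    using fin by (intro sum.union_disjoint) auto
  finally show ?thesis using large[of J] small by simp
qed

text \<open>The number of levels needed is logarithmic in \<open>B / n\<close>, hence at most a multiple of any
  positive power of it.\<close>

lemma log_levels_le_power:
  fixes D K n B s :: real
  assumes D: "\<And>J::nat. D \<le> real J * (K * n\<^sup>2) + (B / 2 ^ J)\<^sup>2"
    and n: "n > 0" and B: "B \<ge> 0" and s: "s > 0" and K: "K \<ge> 0"
  shows "D \<le> (K + 1) * (2 + 1 / s) * (n + B powr s * n powr (1 - s))\<^sup>2"
proof -
  define u where "u = B / n"
  define v where "v = u powr s"
  have u0: "u \<ge> 0" and v0: "v \<ge> 0" using n B by (auto simp: u_def v_def)
  \<comment> \<open>Enough halvings to bring \<open>B\<close> down to \<open>n\<close>: none if u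
    \<le> 1, otherwise the binary logarithm of \<open>u\<close> rounded up.\<close>
  obtain J :: nat where J: "u \<le> 2 ^ J" "real J \<le> 1 + v\<^sup>2 / s"
  proof (cases "u \<le> 1")
    case True
    then show thesis using that[of 0] s v0 by simp
  next
    case False
    then have u1: "u > 1" by simp
    define J where "J = nat \<lceil>log 2 u\<rceil>"
    have l0: "0 < log 2 u" using u1 by simp
    have "log 2 u \<le> real J" unfolding J_def by linarith
    then have "u \<le> 2 ^ J" using u1 by (simp add: log_le_iff powr_realpow)
    moreover have "real J \<le> 1 + v\<^sup>2 / s"
    proof -
      have v2: "v\<^sup>2 = u powr (2 * s)" unfolding v_def by (simp add: power2_eq_square powr_add[symmetric])
      \<comment> \<open>The inequality ln w \<le> w at w = u^(2s) turns the logarithm into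
        \<open>v\<close> squared at the cost of a factor 1/s.\<close>
      have "2 * s * ln u = ln (v\<^sup>2)" unfolding v2 using u1 by (simp add: ln_powr)
      also have "\<dots> \<le> v\<^sup>2" using u1 unfolding v2 by (intro less_imp_le ln_less_self) simp
      finally have "ln u \<le> v\<^sup>2 / (2 * s)" using s by (simp add: field_simps)
      \<comment> \<open>This holds because ln 2 \<ge> 2/3 > 1/2.\<close>
      moreover have "log 2 u \<le> 2 * ln u"
        using u1 ln2_ge_two_thirds by (simp add: log_def divide_le_eq mult_le_cancel_left1)
      ultimately have "log 2 u \<le> v\<^sup>2 / s" by simp
      moreover have "real J \<le> log 2 u + 1" unfolding J_def using l0 by linarith
      ultimately show ?thesis by simp
    qed
    ultimately show thesis by (rule that)
  qed
  have "(B / 2 ^ J)\<^sup>2 \<le> n\<^sup>2"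
    using J(1) n B by (intro power_mono) (auto simp: u_def field_simps)
  then have "D \<le> (real J * K + 1) * n\<^sup>2" using D[of J] by (simp add: algebra_simps)
  also have "\<dots> \<le> ((K + 1) * (2 + 1 / s) * (1 + v)\<^sup>2) * n\<^sup>2"
  proof (rule mult_right_mono)
    have "real J * K + 1 \<le> (K + 1) * (1 + real J)" using K by (simp add: algebra_simps)
    also have "\<dots> \<le> (K + 1) * (2 + v\<^sup>2 / s)" using J(2) K by (intro mult_left_mono) auto
    also have "\<dots> \<le> (K + 1) * ((2 + 1 / s) * (1 + v)\<^sup>2)"
    proof (rule mult_left_mono)
      have "2 + v\<^sup>2 / s \<le> (2 + 1 / s) * (1 + v\<^sup>2)" using s by (simp add: field_simps)
      also have "\<dots> \<le> (2 + 1 / s) * (1 + v)\<^sup>2"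
        using s v0 by (intro mult_left_mono) (auto simp: power2_eq_square algebra_simps)
      finally show "2 + v\<^sup>2 / s \<le> (2 + 1 / s) * (1 + v)\<^sup>2" .
    qed (use K in simp)
    finally show "real J * K + 1 \<le> (K + 1) * (2 + 1 / s) * (1 + v)\<^sup>2" by (simp add: mult.assoc)
  qed simp
  also have "\<dots> = (K + 1) * (2 + 1 / s) * (n + n * v)\<^sup>2"
    by (simp add: power2_eq_square algebra_simps)
  also have "n * v = B powr s * n powr (1 - s)"
    using n B by (simp add: v_def u_def powr_divide powr_diff)
  finally show ?thesis .
qed

subsection \<open>Row sums of the Gram matrix\<close>

lemma well_separatedD:
  assumes "well_separated \<alpha> \<beta> E" "p \<in> E" "q \<in> E" "p \<noteq> q"
  shows "\<alpha> * max (snd (snd p)) (snd (snd q)) < \<bar>fst p - fst q\<bar> \<or>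
    \<beta> * max (1 / snd (snd p)) (1 / snd (snd q)) < \<bar>fst (snd p) - fst (snd q)\<bar>"
  using assms unfolding well_separated_def by (cases p; cases q) fastforce

text \<open>Two packets of scale at most that of \<open>p\<close> that both interact with \<open>p\<close> have
  frequencies within \<open>4 * \<delta>\<close> over the smaller scale, so well-separation forces their positions
  apart and the packing bound applies.\<close>

lemma wave_packet_gram_row_sum:
  assumes cont: "continuous_on UNIV \<phi>" and M: "M > 0"
    and decay: "\<And>x. cmod (\<phi> x) \<le> M * (weight x)\<^sup>2"
    and \<alpha>: "\<alpha> > 0" and \<delta>: "\<delta> > 0" and supp: "supp (fourier \<phi>) \<subseteq> {-\<delta><..<\<delta>}"
    and \<beta>: "\<beta> \<ge> 4 * \<delta>" and E: "E \<subseteq> X" and sep: "well_separated \<alpha> \<beta> E"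
    and F: "finite F" "F \<subseteq> E" and p: "p \<in> E"
  shows "(\<Sum>q\<in>{q\<in>F. snd (snd q) \<le> snd (snd p)}.
      snd (snd q) * cmod (L2_inner (wave_packet \<phi> p) (wave_packet \<phi> q)))
    \<le> 2 * M\<^sup>2 * weight_mass * (2 * (1 + (\<alpha> / 2)\<^sup>2) / \<alpha> * weight_mass)"
proof -
  let ?T = "\<lambda>q :: real \<times> real \<times> real. snd (snd q)"
  let ?G = "\<lambda>q. L2_inner (wave_packet \<phi> p) (wave_packet \<phi> q)"
  \<comment> \<open>Packets orthogonal to \<open>p\<close> contribute nothing; the others have
    frequencies close to that of \<open>p\<close>.\<close>
  define L where "L = {q\<in>F. ?T q \<le> ?T p \<and> ?G q \<noteq> 0}"
  have T: "?T q > 0" if "q \<in> E" for q using E that by (auto simp: X_def)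
  have LE: "q \<in> E" if "q \<in> L" for q using that F by (auto simp: L_def)
  have freq: "\<bar>fst (snd p) - fst (snd q)\<bar> < \<delta> / ?T p + \<delta> / ?T q" if "q \<in> L" for q
    using wave_packet_orthogonal[OF cont M decay T[OF p] T[OF LE[OF that]] supp,
        of "fst p" "fst (snd p)" "fst q" "fst (snd q)"] that
    by (simp add: L_def)
  have pos: "\<alpha> * max (?T q) (?T q') < \<bar>fst q - fst q'\<bar>" if q: "q \<in> L" "q' \<in> L" "q \<noteq> q'" for q q'
  proof -
    let ?m = "max (1 / ?T q) (1 / ?T q')"
    \<comment> \<open>As \<open>p\<close> has the largest scale, all three inverse scales are at
      most \<open>?m\<close>. Comparing both frequencies with that of \<open>p\<close> then costs
      \<delta> / ?T p twice and \<delta> over each smaller scale once, at most 4 * \<delta> * ?m in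
      total.\<close>
    have le: "1 / ?T p \<le> 1 / ?T q"
      using q T[OF LE[OF q(1)]] by (intro divide_left_mono) (auto simp: L_def T[OF p])
    have m: "1 / ?T p \<le> ?m" "1 / ?T q \<le> ?m" "1 / ?T q' \<le> ?m" using le by auto
    have m': "\<delta> / ?T p \<le> \<delta> * ?m" "\<delta> / ?T q \<le> \<delta> * ?m" "\<delta> / ?T q' \<le> \<delta> * ?m"
      using m[THEN mult_left_mono[of _ _ \<delta>]] \<delta> by simp_all
    have "\<bar>fst (snd q) - fst (snd q')\<bar> < 4 * \<delta> * ?m"
      using freq[OF q(1)] freq[OF q(2)] m' by linarith
    also have "\<dots> \<le> \<beta> * ?m" using \<beta> T[OF LE[OF q(1)]] by (intro mult_right_mono) (auto simp: le_max_iff_disj)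
    finally show ?thesis using well_separatedD[OF sep LE[OF q(1)] LE[OF q(2)] q(3)] by linarith
  qed
  have "(\<Sum>q\<in>{q\<in>F. ?T q \<le> ?T p}. ?T q * cmod (?G q)) = (\<Sum>q\<in>L. ?T q * cmod (?G q))"
    using F by (intro sum.mono_neutral_right) (auto simp: L_def)
  also have "\<dots> \<le> (\<Sum>q\<in>L. 2 * M\<^sup>2 * weight_mass / ?T p * (?T q * weight ((fst q - fst p) / ?T p)))"
  proof (rule sum_mono)
    fix q assume q: "q \<in> L"
    have "cmod (?G q) \<le> 2 * M\<^sup>2 * weight_mass / ?T p * weight ((fst q - fst p) / ?T p)"
      using wave_packet_gram_bound[OF cont M decay, of "?T q" "?T p" "fst p" "fst (snd p)" "fst q" "fst (snd q)"]
        q T[OF LE[OF q]] by (simp add: L_def)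
    then have "?T q * cmod (?G q) \<le> ?T q * (2 * M\<^sup>2 * weight_mass / ?T p * weight ((fst q - fst p) / ?T p))"
      using T[OF LE[OF q]] by (intro mult_left_mono) auto
    then show "?T q * cmod (?G q) \<le> 2 * M\<^sup>2 * weight_mass / ?T p * (?T q * weight ((fst q - fst p) / ?T p))"
      by (simp only: mult.left_commute)
  qed
  also have "\<dots> \<le> 2 * M\<^sup>2 * weight_mass / ?T p * (2 * (1 + (\<alpha> / 2)\<^sup>2) / \<alpha> * weight_mass * ?T p)"
    unfolding sum_distrib_left[symmetric]
  proof (rule mult_left_mono)
    show "(\<Sum>q\<in>L. ?T q * weight ((fst q - fst p) / ?T p)) \<le> 2 * (1 + (\<alpha> / 2)\<^sup>2) / \<alpha> * weight_mass * ?T p"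
      by (rule weight_packing[where p=fst]) (use F \<alpha> T LE p pos in \<open>auto simp: L_def\<close>)
  qed (use T[OF p] weight_mass_nonneg in simp)
  \<comment> \<open>The scale of \<open>p\<close> cancels: the Gram bound has it in the denominator,
    the packing bound in the numerator.\<close>
  also have "\<dots> = 2 * M\<^sup>2 * weight_mass * (2 * (1 + (\<alpha> / 2)\<^sup>2) / \<alpha> * weight_mass)"
    using T[OF p] by simp
  finally show ?thesis .
qed

subsection \<open>The embedding estimate\<close>

lemma ennreal_pow_ennreal: "0 \<le> x \<Longrightarrow> ennreal_pow (ennreal x) a = ennreal (x powr a)"
  by (simp add: ennreal_pow_def)

lemma ennreal_pow_eq_0_iff: "ennreal_pow x a = 0 \<longleftrightarrow> x = 0"
  by (cases x) (auto simp: ennreal_pow_def)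

lemma ennreal_pow_mono: "x \<le> y \<Longrightarrow> 0 \<le> a \<Longrightarrow> ennreal_pow x a \<le> ennreal_pow y a"
  by (cases x; cases y) (auto simp: ennreal_pow_def powr_mono2 top_unique)

lemma ennreal_pow_eq_top_iff: "ennreal_pow x a = \<infinity> \<longleftrightarrow> x = \<infinity>"
  by (simp add: ennreal_pow_def)

text \<open>Quantifying \<open>C\<close> before \<delta>, \<beta>, \<open>E\<close> and
  \<open>f\<close> expresses that it depends only on \<phi>, \<alpha> and \<open>s\<close>. Values
  in \<open>ennreal\<close> give a meaning to divergent sums and infinite suprema.\<close>

theorem lemma2:
  fixes \<phi> :: "real \<Rightarrow> complex" and \<alpha> s :: real
  assumes "schwartz \<phi>"
    and "\<alpha> > 0"
    and "0 < s" and "s < 1"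
  shows "\<exists>C::real. C > 0 \<and>
    (\<forall>(\<delta>::real) (\<beta>::real) (E::(real \<times> real \<times> real) set) (f::real \<Rightarrow> complex).
       \<delta> > 0 \<longrightarrow> supp (fourier \<phi>) \<subseteq> {-\<delta><..<\<delta>} \<longrightarrow> \<beta> \<ge> 4 * \<delta> \<longrightarrow>
       E \<subseteq> X \<longrightarrow> countable E \<longrightarrow> well_separated \<alpha> \<beta> E \<longrightarrow> in_L2 f \<longrightarrow>
       ennreal_pow
         (\<Sum>\<^sub>\<infinity>(y, \<eta>, t)\<in>E. ennreal (t * (cmod (L2_inner f (wave_packet \<phi> (y, \<eta>, t))))\<^sup>2)) (1/2)
       \<le> ennreal C *
          (ennreal (L2_norm f) +
           ennreal_pow
             ((SUP p\<in>E. ennreal (cmod (L2_inner f (wave_packet \<phi> p)))) *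
              ennreal_pow (\<Sum>\<^sub>\<infinity>(y, \<eta>, t)\<in>E. ennreal t) (1/2)) s *
           ennreal_pow (ennreal (L2_norm f)) (1 - s)))"
proof -
  have cont: "continuous_on UNIV \<phi>" by (rule schwartz_continuous) fact
  obtain M where M: "M > 0" and decay: "\<And>x. cmod (\<phi> x) \<le> M * (weight x)\<^sup>2"
    using schwartz_decay[OF assms(1)] by blast
  \<comment> \<open>The row-sum bound, enlarged by 1 to make it positive, as
    \<open>weight_mass\<close> is only shown to be nonnegative.\<close>
  define K where "K = 2 * M\<^sup>2 * weight_mass * (2 * (1 + (\<alpha> / 2)\<^sup>2) / \<alpha> * weight_mass) + 1"
  have K: "K > 0"
    unfolding K_def using assms(2) weight_mass_nonneg by (intro add_nonneg_pos mult_nonneg_nonneg divide_nonneg_pos) auto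
  \<comment> \<open>The root of the constant in \<open>log_levels_le_power\<close> for the Bessel
    constant \<open>4 * K\<close> of comparable families.\<close>
  define C where "C = sqrt ((4 * K + 1) * (2 + 1 / s))"
  have C: "C > 0" "C\<^sup>2 = (4 * K + 1) * (2 + 1 / s)"
    unfolding C_def using K assms(3) by (auto simp: add_pos_pos)
  let ?T = "\<lambda>q :: real \<times> real \<times> real. snd (snd q)"
  show ?thesis
  proof (intro exI[of _ C] conjI allI impI C(1))
    fix \<delta> \<beta> :: real and E :: "(real \<times> real \<times> real) set" and f :: "real \<Rightarrow> complex"
    assume hyps: "\<delta> > 0" "supp (fourier \<phi>) \<subseteq> {-\<delta><..<\<delta>}" "\<beta> \<ge> 4 * \<delta>" "E \<subseteq> X" "countable E"
      "well_separated \<alpha> \<beta> E" "in_L2 f"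
    define a where "a p = cmod (L2_inner f (wave_packet \<phi> p))" for p
    define n where "n = L2_norm f"
    define A where "A = (SUP p\<in>E. ennreal (a p))"
    define S where "S = (\<Sum>\<^sub>\<infinity>p\<in>E. ennreal (?T p))"
    define P where "P = (\<Sum>\<^sub>\<infinity>p\<in>E. ennreal (?T p * (a p)\<^sup>2))"
    have T: "?T p > 0" if "p \<in> E" for p using hyps(4) that by (auto simp: X_def)
    have n0: "n \<ge> 0" by (simp add: n_def L2_norm_nonneg)
    have a0: "a p \<ge> 0" for p by (simp add: a_def)
    have comparable: "(\<Sum>p\<in>F. ?T p * (a p)\<^sup>2) \<le> 4 * K * n\<^sup>2"
      if F: "finite F" "F \<subseteq> E" and "\<And>p q. p \<in> F \<Longrightarrow> q \<in> F \<Longrightarrow> a p \<le> 2 * a q" for F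
      unfolding a_def n_def
    proof (rule L2_bessel_comparable)
      show "in_L2 (wave_packet \<phi> p)" if "p \<in> F" for p
        using in_L2_wave_packet[OF cont M decay, of "?T p" "fst p" "fst (snd p)"] T[of p] that F by (simp add: subsetD)
      show "(\<Sum>q\<in>{q\<in>F. ?T q \<le> ?T p}. ?T q * cmod (L2_inner (wave_packet \<phi> p) (wave_packet \<phi> q))) \<le> K"
        if "p \<in> F" for p
        using wave_packet_gram_row_sum[OF cont M decay assms(2) hyps(1-4) hyps(6) F, of p] that F
        by (auto simp: K_def)
    qed (use that T K hyps in \<open>auto simp: a_def\<close>)
    \<comment> \<open>Nonnegative infinite sums are suprema of finite ones, so estimates uniform in
      the finite set \<open>F\<close> suffice.\<close>
    have P_SUP: "P = (SUP F\<in>{F. finite F \<and> F \<subseteq> E}. \<Sum>p\<in>F. ennreal (?T p * (a p)\<^sup>2))"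
      unfolding P_def by (rule nonneg_infsum_complete) simp
    have S_SUP: "S = (SUP F\<in>{F. finite F \<and> F \<subseteq> E}. \<Sum>p\<in>F. ennreal (?T p))"
      unfolding S_def by (rule nonneg_infsum_complete) simp
    have "ennreal_pow P (1/2) \<le> ennreal C * (ennreal n + ennreal_pow (A * ennreal_pow S (1/2)) s * ennreal_pow (ennreal n) (1 - s))"
    proof (cases "\<forall>p\<in>E. a p = 0")
      case True
      then have "P = 0" unfolding P_def by (intro infsum_0) auto
      then show ?thesis by (simp add: ennreal_pow_eq_0_iff[THEN iffD2])
    next
      case False
      then obtain p where p: "p \<in> E" "a p > 0" using a0 by (metis less_eq_real_def)
      \<comment> \<open>A single packet is a comparable family, so its Bessel bound rules out
        \<open>n = 0\<close>.\<close>
      have n: "n > 0"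
      proof (rule ccontr)
        assume "\<not> n > 0"
        then have "n = 0" using n0 by simp
        then have "?T p * (a p)\<^sup>2 \<le> 0" using comparable[of "{p}"] p by simp
        moreover have "0 < ?T p * (a p)\<^sup>2" using p T by simp
        ultimately show False by simp
      qed
      have A0: "A \<noteq> 0"
      proof
        assume "A = 0"
        then have "ennreal (a p) \<le> 0"
          using SUP_upper[OF p(1), of "\<lambda>p. ennreal (a p)"] by (simp only: A_def)
        then show False using p(2) by simp
      qed
      have SF: "ennreal (\<Sum>p\<in>F. ?T p) \<le> S" if "finite F" "F \<subseteq> E" for F
      proof -
        have "ennreal (\<Sum>p\<in>F. ?T p) = (\<Sum>p\<in>F. ennreal (?T p))"
          using T that by (intro sum_ennreal[symmetric] less_imp_le T) blast
        also have "\<dots> \<le> S" unfolding S_SUP using that by (intro SUP_upper) simp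
        finally show ?thesis .
      qed
      have S0: "S \<noteq> 0"
        using SF[of "{p}"] p T[OF p(1)] by auto
      show ?thesis
      proof (cases "A = \<infinity> \<or> S = \<infinity>")
        \<comment> \<open>Since \<open>A\<close>, \<open>S\<close> and \<open>n\<close> are nonzero
          here, an infinite factor makes the right side infinite; in \<open>ennreal\<close> a zero
          factor would have made the product 0.\<close>
        case True
        then have "A * ennreal_pow S (1/2) = \<infinity>"
          using A0 S0 ennreal_pow_eq_0_iff[of S "1/2"] ennreal_pow_eq_top_iff[of S "1/2"]
          by (auto simp: ennreal_mult_eq_top_iff)
        then have "ennreal_pow (A * ennreal_pow S (1/2)) s = \<infinity>"
          by (simp only: ennreal_pow_eq_top_iff)
        moreover have "ennreal_pow (ennreal n) (1 - s) \<noteq> 0"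
          using n by (simp add: ennreal_pow_eq_0_iff)
        ultimately have "ennreal C * (ennreal n + ennreal_pow (A * ennreal_pow S (1/2)) s * ennreal_pow (ennreal n) (1 - s)) = \<infinity>"
          using C by (simp add: ennreal_mult_eq_top_iff)
        then show ?thesis by simp
      next
        case False
        then obtain A' S' where A': "A = ennreal A'" "A' \<ge> 0" and S': "S = ennreal S'" "S' \<ge> 0"
          by (metis ennreal_cases infinity_ennreal_def)
        \<comment> \<open>Chosen so that the trivial bound for the small coefficients, (A' / 2^J)^2
          * S', becomes (B / 2^J)^2.\<close>
        define B where "B = A' * sqrt S'"
        have B: "B \<ge> 0" using A' S' by (simp add: B_def)
        define R where "R = C * (n + B powr s * n powr (1 - s))"
        have R: "R \<ge> 0" using C n B by (simp add: R_def)
        have fin: "(\<Sum>p\<in>F. ?T p * (a p)\<^sup>2) \<le> R\<^sup>2" if F: "finite F" "F \<subseteq> E" for F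
        proof -
          have "(\<Sum>p\<in>F. ?T p * (a p)\<^sup>2) \<le> real J * (4 * K * n\<^sup>2) + (B / 2 ^ J)\<^sup>2" for J
          proof -
            have "a p \<le> A'" if "p \<in> F" for p
              using SUP_upper[of p E "\<lambda>p. ennreal (a p)"] that F A' unfolding A_def by auto
            then have "(\<Sum>p\<in>F. ?T p * (a p)\<^sup>2) \<le> real J * (4 * K * n\<^sup>2) + (A' / 2 ^ J)\<^sup>2 * (\<Sum>p\<in>F. ?T p)"
            proof (intro sum_dyadic_levels comparable F(1) a0)
              show "0 \<le> ?T p" if "p \<in> F" for p
                using that F by (intro less_imp_le T) blast
              show "finite G" "G \<subseteq> E" if "G \<subseteq> F" for G
                using that F by (auto intro: finite_subset)
            qed
            also have "(\<Sum>p\<in>F. ?T p) \<le> S'" using SF[OF F] S' by simp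
            then have "(A' / 2 ^ J)\<^sup>2 * (\<Sum>p\<in>F. ?T p) \<le> (A' / 2 ^ J)\<^sup>2 * S'" by (intro mult_left_mono) auto
            also have "\<dots> = (B / 2 ^ J)\<^sup>2" using S' by (simp add: B_def power_divide power_mult_distrib)
            finally show ?thesis by simp
          qed
          then have "(\<Sum>p\<in>F. ?T p * (a p)\<^sup>2) \<le> (4 * K + 1) * (2 + 1 / s) * (n + B powr s * n powr (1 - s))\<^sup>2"
            using n B K assms(3) by (intro log_levels_le_power) auto
          then show ?thesis by (simp add: R_def power_mult_distrib C(2))
        qed
        have "P \<le> ennreal (R\<^sup>2)"
          unfolding P_SUP
        proof (rule SUP_least)
          fix F assume "F \<in> {F. finite F \<and> F \<subseteq> E}"
          then have F: "finite F" "F \<subseteq> E" by auto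
          have "(\<Sum>p\<in>F. ennreal (?T p * (a p)\<^sup>2)) = ennreal (\<Sum>p\<in>F. ?T p * (a p)\<^sup>2)"
            using T F by (intro sum_ennreal mult_nonneg_nonneg less_imp_le[OF T] zero_le_power2) blast
          also have "\<dots> \<le> ennreal (R\<^sup>2)" using fin[OF F] by (rule ennreal_leI)
          finally show "(\<Sum>p\<in>F. ennreal (?T p * (a p)\<^sup>2)) \<le> ennreal (R\<^sup>2)" .
        qed
        then have "ennreal_pow P (1/2) \<le> ennreal_pow (ennreal (R\<^sup>2)) (1/2)"
          by (rule ennreal_pow_mono) simp
        also have "\<dots> = ennreal R" using R by (simp add: ennreal_pow_ennreal powr_half_sqrt)
        also have "\<dots> = ennreal C * (ennreal n + ennreal_pow (A * ennreal_pow S (1/2)) s * ennreal_pow (ennreal n) (1 - s))"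
          using A' S' n B C
          by (simp add: R_def B_def ennreal_pow_ennreal powr_half_sqrt ennreal_mult[symmetric] ennreal_plus[symmetric] del: ennreal_plus)
        finally show ?thesis .
      qed
    qed
    moreover have "P = (\<Sum>\<^sub>\<infinity>(y, \<eta>, t)\<in>E. ennreal (t * (cmod (L2_inner f (wave_packet \<phi> (y, \<eta>, t))))\<^sup>2))"
      unfolding P_def a_def by (intro infsum_cong) auto
    moreover have "S = (\<Sum>\<^sub>\<infinity>(y, \<eta>, t)\<in>E. ennreal t)"
      unfolding S_def by (intro infsum_cong) auto
    ultimately show "ennreal_pow
         (\<Sum>\<^sub>\<infinity>(y, \<eta>, t)\<in>E. ennreal (t * (cmod (L2_inner f (wave_packet \<phi> (y, \<eta>, t))))\<^sup>2)) (1/2)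
       \<le> ennreal C *
          (ennreal (L2_norm f) +
           ennreal_pow
             ((SUP p\<in>E. ennreal (cmod (L2_inner f (wave_packet \<phi> p)))) *
              ennreal_pow (\<Sum>\<^sub>\<infinity>(y, \<eta>, t)\<in>E. ennreal t) (1/2)) s *
           ennreal_pow (ennreal (L2_norm f)) (1 - s))"
      by (simp only: A_def n_def a_def)
  qed
qed

end
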